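(* Let $m,n$ be integers with $2\le m<\frac{n}{2}$. Then $\dim(K_{1,m}\square K_{1,n})=n-1$.
   Context: All graphs are finite and simple; $d(u,v)$ is the length of a shortest path. For a connected graph $G$ and $W=\{w_1,\dots,w_k\}\subseteq V(G)$ (ordered), the metric representation of a vertex $v$ is $r(v|W)=(d(v,w_1),\dots,d(v,w_k))$. $W$ is a resolving set if distinct vertices of $G$ have distinct metric representations with respect to $W$. The metric dimension $\dim(G)$ is the minimum cardinality of a resolving set. $K_{1,n}$ is the star with $n$ leaves. The Cartesian product $G\square H$ has vertex set $V(G)\times V(H)$, with $(u,v)$ adjacent to $(u',v')$ iff $u=u'$ and $vv'\in E(H)$, or $v=v'$ and $uu'\in E(G)$. *)

theory Defs
  imports "Graph_Theory.Graph_Theory"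
begin

(* A finite simple graph is a symmetric, loop-free finite pair digraph: an edge uv is represented
   by the two arcs (u,v) and (v,u). *)

definition star_graph :: "nat \<Rightarrow> nat pair_pre_digraph" where
  "star_graph n = \<lparr> pverts = {0..n}, parcs = {0} \<times> {1..n} \<union> {1..n} \<times> {0} \<rparr>"

definition cartesian_product ::
    "'a pair_pre_digraph \<Rightarrow> 'b pair_pre_digraph \<Rightarrow> ('a \<times> 'b) pair_pre_digraph"
    (infixl \<open>\<box>\<close> 70) where
  "G \<box> H = \<lparr> pverts = pverts G \<times> pverts H,
     parcs = {((u, v), (u', v')). u = u' \<and> u \<in> pverts G \<and> (v, v') \<in> parcs H
                                \<or> v = v' \<and> v \<in> pverts H \<and> (u, u') \<in> parcs G} \<rparr>"

(* Only meaningful if v is reachable from u. *)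
definition graph_dist :: "'a pair_pre_digraph \<Rightarrow> 'a \<Rightarrow> 'a \<Rightarrow> nat" where
  "graph_dist G u v = (LEAST k. \<exists>p. pre_digraph.apath (with_proj G) u p v \<and> length p = k)"

definition metric_rep :: "'a pair_pre_digraph \<Rightarrow> 'a list \<Rightarrow> 'a \<Rightarrow> nat list" where
  "metric_rep G ws v = map (graph_dist G v) ws"

(* Whether the representations are distinct does not depend on the chosen ordering ws of W. *)
definition resolving_set :: "'a pair_pre_digraph \<Rightarrow> 'a set \<Rightarrow> bool" where
  "resolving_set G W \<longleftrightarrow> W \<subseteq> pverts G \<and>
     (\<exists>ws. distinct ws \<and> set ws = W \<and> inj_on (metric_rep G ws) (pverts G))"

definition metric_dim :: "'a pair_pre_digraph \<Rightarrow> nat" where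
  "metric_dim G = (LEAST k. \<exists>W. resolving_set G W \<and> card W = k)"

lemma pair_graph_star_graph: "pair_graph (star_graph n)"
  by unfold_locales
    (auto simp: star_graph_def symmetric_def sym_def)

lemma pair_graph_cartesian_product:
  assumes "pair_graph G" "pair_graph H"
  shows "pair_graph (G \<box> H)"
proof -
  interpret G: pair_graph G by fact
  interpret H: pair_graph H by fact
  have sub: "parcs (G \<box> H) \<subseteq> pverts (G \<box> H) \<times> pverts (G \<box> H)"
    by (auto simp: cartesian_product_def dest: G.wellformed' H.wellformed')
  have fin: "finite (pverts (G \<box> H))"
    by (simp add: cartesian_product_def G.pair_finite_verts H.pair_finite_verts)
  show ?thesis
  proof
    show "finite (parcs (G \<box> H))"
      using sub fin finite_subset by blast
    show "symmetric (with_proj (G \<box> H))"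
      by (auto simp: symmetric_def sym_def cartesian_product_def
               intro: G.arcs_symmetric H.arcs_symmetric)
    show "fst e \<noteq> snd e" if "e \<in> parcs (G \<box> H)" for e
      using that by (auto simp: cartesian_product_def dest: G.no_loops' H.no_loops')
  qed (use sub fin in auto)
qed

lemma strongly_connected_star_graph: "strongly_connected (with_proj (star_graph n))"
proof -
  interpret pair_graph "star_graph n" by (rule pair_graph_star_graph)
  have "0 \<rightarrow>\<^sup>*\<^bsub>with_proj (star_graph n)\<^esub> v \<and> v \<rightarrow>\<^sup>*\<^bsub>with_proj (star_graph n)\<^esub> 0"
    if "v \<in> pverts (star_graph n)" for v
  proof (cases "v = 0")
    case True
    then show ?thesis
      using that by simp
  next
    case False
    then have "(0, v) \<in> parcs (star_graph n)" "(v, 0) \<in> parcs (star_graph n)"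
      using that by (auto simp: star_graph_def)
    then show ?thesis
      by (intro conjI reachable_adjI)
  qed
  then have "u \<rightarrow>\<^sup>*\<^bsub>with_proj (star_graph n)\<^esub> v"
    if "u \<in> pverts (star_graph n)" "v \<in> pverts (star_graph n)" for u v
    using that by (meson reachable_trans)
  moreover have "pverts (star_graph n) \<noteq> {}"
    by (simp add: star_graph_def)
  ultimately show ?thesis
    by (simp add: strongly_connected_def)
qed

lemma strongly_connected_cartesian_product:
  assumes "pair_graph G" "pair_graph H"
    and "strongly_connected (with_proj G)" "strongly_connected (with_proj H)"
  shows "strongly_connected (with_proj (G \<box> H))"
proof -
  interpret G: pair_graph G by fact
  interpret H: pair_graph H by fact
  interpret P: pair_graph "G \<box> H"
    using assms(1,2) by (rule pair_graph_cartesian_product)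
  have left: "(u, v) \<rightarrow>\<^sup>*\<^bsub>with_proj (G \<box> H)\<^esub> (u', v)"
    if "u \<rightarrow>\<^sup>*\<^bsub>with_proj G\<^esub> u'" "v \<in> pverts H" for u u' v
    using that(1)
  proof (induct rule: G.reachable_induct)
    case base
    then show ?case
      using that(2) by (intro P.reachable_refl) (simp add: cartesian_product_def)
  next
    case (step x y)
    then have "(x, v) \<rightarrow>\<^bsub>with_proj (G \<box> H)\<^esub> (y, v)"
      using that(2) by (simp add: cartesian_product_def)
    with step(3) show ?case
      by (rule wf_digraph.reachable_adj_trans[OF P.wf_digraph])
  qed
  have right: "(u, v) \<rightarrow>\<^sup>*\<^bsub>with_proj (G \<box> H)\<^esub> (u, v')"
    if "v \<rightarrow>\<^sup>*\<^bsub>with_proj H\<^esub> v'" "u \<in> pverts G" for u v v'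
    using that(1)
  proof (induct rule: H.reachable_induct)
    case base
    then show ?case
      using that(2) by (intro P.reachable_refl) (simp add: cartesian_product_def)
  next
    case (step x y)
    then have "(u, x) \<rightarrow>\<^bsub>with_proj (G \<box> H)\<^esub> (u, y)"
      using that(2) by (simp add: cartesian_product_def)
    with step(3) show ?case
      by (rule wf_digraph.reachable_adj_trans[OF P.wf_digraph])
  qed
  show ?thesis
    unfolding strongly_connected_def
  proof (intro conjI ballI)
    show "verts (with_proj (G \<box> H)) \<noteq> {}"
      using assms(3,4) by (auto simp: strongly_connected_def cartesian_product_def)
    fix a b
    assume "a \<in> verts (with_proj (G \<box> H))" "b \<in> verts (with_proj (G \<box> H))"
    then obtain u v u' v' where ab: "a = (u, v)" "b = (u', v')"
      "u \<in> pverts G" "u' \<in> pverts G" "v \<in> pverts H" "v' \<in> pverts H"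
      by (auto simp: cartesian_product_def)
    have "u \<rightarrow>\<^sup>*\<^bsub>with_proj G\<^esub> u'" "v \<rightarrow>\<^sup>*\<^bsub>with_proj H\<^esub> v'"
      using ab assms(3,4) by (auto simp: strongly_connected_def)
    then show "a \<rightarrow>\<^sup>*\<^bsub>with_proj (G \<box> H)\<^esub> b"
      unfolding ab(1,2) using ab(4,5) by (intro P.reachable_trans[OF left right])
  qed
qed

lemma graph_dist_eq_\<mu>:
  assumes "pair_graph G" "u \<rightarrow>\<^sup>*\<^bsub>with_proj G\<^esub> v"
  shows "ereal (real (graph_dist G u v)) = wf_digraph.\<mu> (with_proj G) (\<lambda>_. 1) u v"
proof -
  interpret pair_graph G by fact
  have cost: "awalk_cost (\<lambda>_. 1) p = real (length p)" for p :: "('a \<times> 'a) list"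
    by (induct p) auto
  obtain p where p: "apath u p v" "\<mu> (\<lambda>_. 1) u v = ereal (real (length p))"
    using min_cost_awalk[OF assms(2), of "\<lambda>_. 1"] by (auto simp: cost)
  have "length p \<le> length q" if "apath u q v" for q
    using min_cost_le_walk_cost[OF awalkI_apath[OF that], of "\<lambda>_. 1"] p(2)
    by (simp add: cost)
  then have "graph_dist G u v = length p"
    unfolding graph_dist_def using p(1) by (intro Least_equality) auto
  then show ?thesis
    using p(2) by simp
qed

end

theory Submission
  imports Defs
begin

text \<open>
  In a Cartesian product distances add up, and in a star two different leaves are at distance 2 and
  a leaf is at distance 1 from the centre. Everything is read off from these two facts. Think of the
  vertices of \<open>star_graph m \<box> star_graph n\<close> as the cells of a grid with rows \<open>0..m\<close> and columns
  \<open>0..n\<close>.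

  Lower bound (\<open>card_resolving_set_product_star\<close>): two cells of the same row in different leaf
  columns \<open>j\<close> and \<open>j'\<close> have the same distance to every cell outside these two columns. So a
  resolving set misses at most one leaf column, and has at least \<open>n - 1\<close> elements.

  Upper bound (\<open>resolving_set_star_product\<close>): choose one cell in each of the columns
  \<open>1..n - 1\<close> so that every row \<open>1..m\<close> is chosen at least twice; this is possible since
  \<open>n - 1 \<ge> 2 * m\<close>. An unresolved pair of cells that differ in both coordinates would force the
  landmarks of some leaf row to lie in a single column, whereas those of
  each leaf row lie in two different columns. A pair that differs in one coordinate only is
  resolved by a landmark in the row or column of one of its cells, except for the columns \<open>0\<close>
  and \<open>n\<close>, which every landmark tells apart.
\<close>

section \<open>Distances in Cartesian products\<close>

text \<open>Relation powers record only the ends and the length of a walk. This loses nothing that matters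
  for distances, and splitting a walk in a product becomes an induction on the exponent.\<close>

lemma ex_awalk_length_iff_relpow:
  assumes "pair_graph G" "u \<in> pverts G"
  shows "(\<exists>p. pre_digraph.awalk (with_proj G) u p v \<and> length p = k) \<longleftrightarrow> (u, v) \<in> parcs G ^^ k"
  using assms(2)
proof (induction k arbitrary: u)
  case 0
  interpret pair_graph G by fact
  show ?case
    using 0 by (auto simp: awalk_Nil_iff)
next
  case (Suc k)
  interpret pair_graph G by fact
  have "(\<exists>p. awalk u p v \<and> length p = Suc k) \<longleftrightarrow>
      (\<exists>w. (u, w) \<in> parcs G \<and> (\<exists>p. awalk w p v \<and> length p = k))"
  proof
    assume "\<exists>p. awalk u p v \<and> length p = Suc k"
    then obtain e p where "awalk u (e # p) v" "length p = k"
      by (metis length_Suc_conv)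
    then show "\<exists>w. (u, w) \<in> parcs G \<and> (\<exists>p. awalk w p v \<and> length p = k)"
      by (cases e) (auto simp: awalk_Cons_iff)
  next
    assume "\<exists>w. (u, w) \<in> parcs G \<and> (\<exists>p. awalk w p v \<and> length p = k)"
    then obtain w p where "(u, w) \<in> parcs G" "awalk w p v" "length p = k"
      by auto
    then have "awalk u ((u, w) # p) v" "length ((u, w) # p) = Suc k"
      by (simp_all add: awalk_Cons_iff)
    then show "\<exists>p. awalk u p v \<and> length p = Suc k"
      by (intro exI conjI)
  qed
  also have "\<dots> \<longleftrightarrow> (\<exists>w. (u, w) \<in> parcs G \<and> (w, v) \<in> parcs G ^^ k)"
    using Suc.IH[OF in_arcsD2] by blast
  also have "\<dots> \<longleftrightarrow> (u, v) \<in> parcs G ^^ Suc k"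
    by (meson relpow_Suc_D2 relpow_Suc_I2)
  finally show ?case .
qed

lemma graph_dist_le_relpow:
  assumes "pair_graph G" "u \<in> pverts G" "(u, v) \<in> parcs G ^^ k"
  shows "graph_dist G u v \<le> k"
proof -
  interpret pair_graph G by fact
  have cost: "awalk_cost (\<lambda>_. 1) p = real (length p)" for p :: "('a \<times> 'a) list"
    by (induct p) auto
  obtain p where p: "awalk u p v" "length p = k"
    using ex_awalk_length_iff_relpow[OF assms(1,2), of v k] assms(3) by auto
  from p(1) have "u \<rightarrow>\<^sup>*\<^bsub>with_proj G\<^esub> v"
    by (rule reachable_awalkI)
  then have "ereal (real (graph_dist G u v)) = \<mu> (\<lambda>_. 1) u v"
    by (rule graph_dist_eq_\<mu>[OF assms(1)])
  also have "\<dots> \<le> ereal (real k)"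
    using min_cost_le_walk_cost[OF p(1), of "\<lambda>_. 1"] p(2) by (simp add: cost)
  finally show ?thesis
    by simp
qed

lemma relpow_graph_dist:
  assumes "pair_graph G" "u \<rightarrow>\<^sup>*\<^bsub>with_proj G\<^esub> v"
  shows "(u, v) \<in> parcs G ^^ graph_dist G u v"
proof -
  interpret pair_graph G by fact
  have "\<exists>k p. apath u p v \<and> length p = k"
    using assms(2) reachable_apath by blast
  then have "\<exists>p. apath u p v \<and> length p = graph_dist G u v"
    unfolding graph_dist_def by (rule LeastI_ex)
  then have "\<exists>p. awalk u p v \<and> length p = graph_dist G u v"
    using awalkI_apath by blast
  moreover have "u \<in> pverts G"
    using reachable_in_verts(1)[OF assms(2)] by simp
  ultimately show ?thesis
    using ex_awalk_length_iff_relpow[OF assms(1)] by simp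
qed

text \<open>A walk in the product moves in one coordinate at a time; its moves in the two coordinates can
  be interleaved at will.\<close>

lemma relpow_cartesian_product_iff:
  assumes "u \<in> pverts G" "v \<in> pverts H" "pair_graph G" "pair_graph H"
  shows "((u, v), (u', v')) \<in> parcs (G \<box> H) ^^ k \<longleftrightarrow>
    (\<exists>a b. k = a + b \<and> (u, u') \<in> parcs G ^^ a \<and> (v, v') \<in> parcs H ^^ b)"
proof
  interpret G: pair_graph G by fact
  interpret H: pair_graph H by fact
  show "\<exists>a b. k = a + b \<and> (u, u') \<in> parcs G ^^ a \<and> (v, v') \<in> parcs H ^^ b"
    if "((u, v), (u', v')) \<in> parcs (G \<box> H) ^^ k"
    using that
  proof (induction k arbitrary: u' v')
    case 0
    then have "(u, u') \<in> parcs G ^^ 0" "(v, v') \<in> parcs H ^^ 0"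
      by auto
    then show ?case
      by (metis add_0)
  next
    case (Suc k)
    then obtain x y where xy: "((u, v), (x, y)) \<in> parcs (G \<box> H) ^^ k"
      "((x, y), (u', v')) \<in> parcs (G \<box> H)"
      by auto
    obtain a b where ab: "k = a + b" "(u, x) \<in> parcs G ^^ a" "(v, y) \<in> parcs H ^^ b"
      using Suc.IH[OF xy(1)] by blast
    from xy(2) consider "x = u'" "(y, v') \<in> parcs H" | "y = v'" "(x, u') \<in> parcs G"
      by (auto simp: cartesian_product_def)
    then show ?case
    proof cases
      case 1
      then have "(u, u') \<in> parcs G ^^ a" "(v, v') \<in> parcs H ^^ Suc b"
        using ab by auto
      then show ?thesis
        using ab(1) by (metis add_Suc_right)
    next
      case 2
      then have "(u, u') \<in> parcs G ^^ Suc a" "(v, v') \<in> parcs H ^^ b"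
        using ab by auto
      then show ?thesis
        using ab(1) by (metis add_Suc)
    qed
  qed
  have left: "((u, v), (x, v)) \<in> parcs (G \<box> H) ^^ a" if "(u, x) \<in> parcs G ^^ a" for x a
    using that
  proof (induction a arbitrary: x)
    case (Suc a)
    then obtain y where "(u, y) \<in> parcs G ^^ a" "(y, x) \<in> parcs G"
      by auto
    moreover from this have "((y, v), (x, v)) \<in> parcs (G \<box> H)"
      using assms(2) by (simp add: cartesian_product_def)
    ultimately show ?case
      using Suc.IH by auto
  qed auto
  have right: "((x, v), (x, y)) \<in> parcs (G \<box> H) ^^ b"
    if "(v, y) \<in> parcs H ^^ b" "x \<in> pverts G" for x y b
    using that(1)
  proof (induction b arbitrary: y)
    case (Suc b)
    then obtain z where "(v, z) \<in> parcs H ^^ b" "(z, y) \<in> parcs H"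
      by auto
    moreover from this have "((x, z), (x, y)) \<in> parcs (G \<box> H)"
      using that(2) by (simp add: cartesian_product_def)
    ultimately show ?case
      using Suc.IH by auto
  qed auto
  assume "\<exists>a b. k = a + b \<and> (u, u') \<in> parcs G ^^ a \<and> (v, v') \<in> parcs H ^^ b"
  then obtain a b where ab: "k = a + b" "(u, u') \<in> parcs G ^^ a" "(v, v') \<in> parcs H ^^ b"
    by blast
  have "u' \<in> pverts G"
    using ab(2) assms(1) by (cases a) (auto dest: G.in_arcsD2)
  then show "((u, v), (u', v')) \<in> parcs (G \<box> H) ^^ k"
    unfolding ab(1) relpow_add using left[OF ab(2)] right[OF ab(3)] by blast
qed

lemma graph_dist_cartesian_product:
  assumes G: "pair_graph G" "strongly_connected (with_proj G)"
    and H: "pair_graph H" "strongly_connected (with_proj H)"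
    and uv: "u \<in> pverts G" "v \<in> pverts H" "u' \<in> pverts G" "v' \<in> pverts H"
  shows "graph_dist (G \<box> H) (u, v) (u', v') = graph_dist G u u' + graph_dist H v v'"
proof -
  let ?P = "G \<box> H"
  have P: "pair_graph ?P" "strongly_connected (with_proj ?P)"
    using pair_graph_cartesian_product[OF G(1) H(1)]
      strongly_connected_cartesian_product[OF G(1) H(1) G(2) H(2)] by auto
  have mem: "(u, v) \<in> pverts ?P" "(u', v') \<in> pverts ?P"
    using uv by (auto simp: cartesian_product_def)
  have reach: "u \<rightarrow>\<^sup>*\<^bsub>with_proj G\<^esub> u'" "v \<rightarrow>\<^sup>*\<^bsub>with_proj H\<^esub> v'"
    "(u, v) \<rightarrow>\<^sup>*\<^bsub>with_proj ?P\<^esub> (u', v')"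
    using G(2) H(2) P(2) uv mem by (auto simp: strongly_connected_def)
  have iff: "((u, v), (u', v')) \<in> parcs ?P ^^ k \<longleftrightarrow>
    (\<exists>a b. k = a + b \<and> (u, u') \<in> parcs G ^^ a \<and> (v, v') \<in> parcs H ^^ b)" for k
    by (rule relpow_cartesian_product_iff[OF uv(1,2) G(1) H(1)])
  show ?thesis
  proof (rule antisym)
    show "graph_dist ?P (u, v) (u', v') \<le> graph_dist G u u' + graph_dist H v v'"
      using relpow_graph_dist[OF G(1) reach(1)] relpow_graph_dist[OF H(1) reach(2)] iff
      by (intro graph_dist_le_relpow[OF P(1) mem(1)]) blast
    obtain a b where "graph_dist ?P (u, v) (u', v') = a + b"
      "(u, u') \<in> parcs G ^^ a" "(v, v') \<in> parcs H ^^ b"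
      using relpow_graph_dist[OF P(1) reach(3)] iff by blast
    then show "graph_dist G u u' + graph_dist H v v' \<le> graph_dist ?P (u, v) (u', v')"
      using graph_dist_le_relpow[OF G(1) uv(1)] graph_dist_le_relpow[OF H(1) uv(2)]
      by (simp add: add_mono)
  qed
qed

section \<open>Distances in stars\<close>

definition star_dist :: "nat \<Rightarrow> nat \<Rightarrow> nat" where
  "star_dist i j = (if i = j then 0 else if i = 0 \<or> j = 0 then 1 else 2)"

lemma graph_dist_star_graph:
  assumes "i \<le> n" "j \<le> n"
  shows "graph_dist (star_graph n) i j = star_dist i j"
proof -
  let ?A = "parcs (star_graph n)"
  let ?d = "graph_dist (star_graph n) i j"
  have mem: "i \<in> pverts (star_graph n)" "j \<in> pverts (star_graph n)"
    using assms by (auto simp: star_graph_def)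
  have arc: "(x, y) \<in> ?A \<longleftrightarrow> x = 0 \<and> 1 \<le> y \<and> y \<le> n \<or> y = 0 \<and> 1 \<le> x \<and> x \<le> n" for x y
    by (auto simp: star_graph_def)
  have walk: "(i, j) \<in> ?A ^^ ?d"
    using strongly_connected_star_graph mem
    by (intro relpow_graph_dist[OF pair_graph_star_graph]) (auto simp: strongly_connected_def)
  have "(i, j) \<in> ?A ^^ star_dist i j"
    using assms by (auto simp: star_dist_def arc numeral_2_eq_2)
  then have "?d \<le> star_dist i j"
    by (rule graph_dist_le_relpow[OF pair_graph_star_graph mem(1)])
  moreover have "?d \<noteq> 0" if "i \<noteq> j"
    using walk that by (cases ?d) auto
  moreover have "?d \<noteq> 1" if "i \<noteq> 0" "j \<noteq> 0"
  proof
    assume "?d = 1"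
    then show False
      using walk that by (simp add: arc)
  qed
  ultimately show ?thesis
    by (force simp: star_dist_def split: if_splits)
qed

section \<open>Resolving sets and the lower bound\<close>

lemma resolving_set_iff:
  "resolving_set G W \<longleftrightarrow> W \<subseteq> pverts G \<and> finite W \<and>
    (\<forall>x\<in>pverts G. \<forall>y\<in>pverts G. (\<forall>w\<in>W. graph_dist G x w = graph_dist G y w) \<longrightarrow> x = y)"
    (is "_ \<longleftrightarrow> ?R")
proof -
  have rep: "metric_rep G ws x = metric_rep G ws y \<longleftrightarrow>
      (\<forall>w\<in>set ws. graph_dist G x w = graph_dist G y w)" for ws x y
    by (simp add: metric_rep_def)
  show ?thesis
  proof
    assume "resolving_set G W"
    then show "?R"
      unfolding resolving_set_def inj_on_def rep by auto
  next
    assume R: "?R"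
    then obtain ws where "distinct ws" "set ws = W"
      using finite_distinct_list[of W] by auto
    with R show "resolving_set G W"
      unfolding resolving_set_def inj_on_def rep by blast
  qed
qed

text \<open>Two leaf columns of a product with a star look the same from everywhere outside them.\<close>

lemma card_resolving_set_product_star:
  assumes G: "pair_graph G" "strongly_connected (with_proj G)"
    and W: "resolving_set (G \<box> star_graph n) W"
  shows "n - 1 \<le> card W"
proof -
  have fin: "finite W" and sub: "W \<subseteq> pverts G \<times> {0..n}"
    using W by (auto simp: resolving_set_iff cartesian_product_def star_graph_def)
  obtain u where u: "u \<in> pverts G"
    using G(2) by (auto simp: strongly_connected_def)
  have eq: "j = j'" if j: "j \<in> {1..n} - snd ` W" "j' \<in> {1..n} - snd ` W" for j j'
  proof -
    have "graph_dist (G \<box> star_graph n) (u, j) w = graph_dist (G \<box> star_graph n) (u, j') w"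
      if "w \<in> W" for w
    proof -
      obtain x k where w: "w = (x, k)" "x \<in> pverts G" "k \<le> n"
        using \<open>w \<in> W\<close> sub by auto
      have "k \<noteq> j" "k \<noteq> j'"
        using j \<open>w \<in> W\<close> w(1) by force+
      have dist: "graph_dist (G \<box> star_graph n) (u, i) w = graph_dist G u x + star_dist i k"
        if "i \<le> n" for i
        using graph_dist_cartesian_product[OF G pair_graph_star_graph
            strongly_connected_star_graph u, of i n x k] that w
        by (simp add: graph_dist_star_graph) (simp add: star_graph_def)
      show ?thesis
        using dist j \<open>k \<noteq> j\<close> \<open>k \<noteq> j'\<close> by (auto simp: star_dist_def)
    qed
    moreover have "(u, j) \<in> pverts (G \<box> star_graph n)" "(u, j') \<in> pverts (G \<box> star_graph n)"
      using u j by (auto simp: cartesian_product_def star_graph_def)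
    ultimately show ?thesis
      using W unfolding resolving_set_iff by blast
  qed
  have "card {1..n} - card (snd ` W) \<le> card ({1..n} - snd ` W)"
    by (rule diff_card_le_card_Diff) (simp add: fin)
  also have "\<dots> \<le> 1"
    using eq by (simp add: card_le_Suc0_iff_eq)
  finally show ?thesis
    using card_image_le[OF fin, of snd] by simp
qed

section \<open>A small resolving set\<close>

text \<open>This is the combinatorial core of the upper bound; the landmarks are the cells \<open>(r k, k)\<close>.
  Suppose that \<open>i \<noteq> i'\<close>, where by symmetry \<open>i'\<close> is a leaf. A landmark in row \<open>i'\<close> is closer to row
  \<open>i'\<close> than to row \<open>i\<close>, so its column has to be closer to \<open>j\<close> than to \<open>j'\<close> by the same amount. This
  puts it into column \<open>j\<close>, where there is no room for the second landmark of row \<open>i'\<close>, unless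
  \<open>i\<close> and \<open>j\<close> are both the centre and \<open>j'\<close> is a leaf. In that case the landmarks of any other leaf
  row are closer to \<open>i\<close> than to \<open>i'\<close>, hence closer to \<open>j'\<close> than to \<open>j\<close>, and so both lie in column
  \<open>j'\<close>, which is again impossible.\<close>

lemma star_dist_sum_separates:
  assumes m: "2 \<le> m" and n: "2 \<le> n"
    and twice: "\<And>i. i \<in> {1..m} \<Longrightarrow> \<exists>k\<in>{1..<n}. \<exists>l\<in>{1..<n}. k \<noteq> l \<and> r k = i \<and> r l = i"
    and le: "i \<le> m" "i' \<le> m" "j \<le> n" "j' \<le> n"
    and eq: "\<And>k. k \<in> {1..<n} \<Longrightarrow>
      star_dist i (r k) + star_dist j k = star_dist i' (r k) + star_dist j' k"
  shows "i = i' \<and> j = j'"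
proof -
  have no_row_change: False
    if "a \<noteq> a'" "a' \<noteq> 0" "a' \<le> m"
      and eq': "\<And>k. k \<in> {1..<n} \<Longrightarrow>
        star_dist a (r k) + star_dist b k = star_dist a' (r k) + star_dist b' k"
    for a a' b b'
  proof -
    have "a' \<in> {1..m}"
      using that(2,3) by simp
    then obtain k l where kl: "k \<in> {1..<n}" "l \<in> {1..<n}" "k \<noteq> l" "r k = a'" "r l = a'"
      by (meson twice)
    have step: "star_dist a a' + star_dist b k = star_dist b' k"
      "star_dist a a' + star_dist b l = star_dist b' l"
      using eq'[OF kl(1)] eq'[OF kl(2)] kl(4,5) by (simp_all add: star_dist_def)
    have "a = 0 \<and> b = 0 \<and> b' \<noteq> 0"
      using step that(1,2) kl(1-3) by (auto simp: star_dist_def split: if_splits)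
    \<comment> \<open>Two landmarks of another leaf row \<open>q\<close> would both lie in column \<open>b'\<close>.\<close>
    moreover obtain q where q: "q \<in> {1..m}" "q \<noteq> a'"
    proof (cases "a' = 1")
      case True
      then show thesis
        using m by (intro that[of 2]) auto
    next
      case False
      then show thesis
        using m by (intro that[of 1]) auto
    qed
    moreover obtain k' l' where kl': "k' \<in> {1..<n}" "l' \<in> {1..<n}" "k' \<noteq> l'" "r k' = q" "r l' = q"
      using q(1) by (meson twice)
    ultimately show False
      using eq'[OF kl'(1)] eq'[OF kl'(2)] that(2)
      by (simp add: star_dist_def split: if_splits)
  qed
  have row: "i = i'"
  proof (rule ccontr)
    assume "i \<noteq> i'"
    then show False
      using no_row_change[of i i' j j'] no_row_change[of i' i j' j] le(1,2) eq by force
  qed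
  have col: "star_dist j k = star_dist j' k" if "k \<in> {1..<n}" for k
    using eq[OF that] row by simp
  have "j = j'"
  proof (rule ccontr)
    assume "j \<noteq> j'"
    then have "j \<notin> {1..<n}" "j' \<notin> {1..<n}"
      using col[of j] col[of j'] by (auto simp: star_dist_def split: if_splits)
    then have "j = 0 \<and> j' = n \<or> j = n \<and> j' = 0"
      using le(3,4) \<open>j \<noteq> j'\<close> by auto
    then show False
      using col[of 1] n by (auto simp: star_dist_def split: if_splits)
  qed
  with row show ?thesis
    by simp
qed

text \<open>Column \<open>n\<close> is the one that may stay empty. Columns \<open>i\<close> and \<open>m + i\<close> serve row \<open>i\<close>; columns
  beyond \<open>2 * m\<close> only have to be hit somewhere.\<close>

definition landmark_row :: "nat \<Rightarrow> nat \<Rightarrow> nat" where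
  "landmark_row m k = (if k \<le> m then k else if k \<le> 2 * m then k - m else 1)"

lemma resolving_set_star_product:
  assumes m: "2 \<le> m" and n: "2 * m < n"
  shows "resolving_set (star_graph m \<box> star_graph n) ((\<lambda>k. (landmark_row m k, k)) ` {1..<n})"
    (is "resolving_set ?P ?W")
proof -
  have row_le: "landmark_row m k \<in> {1..m}" if "k \<in> {1..<n}" for k
    using that m by (auto simp: landmark_row_def)
  have twice: "\<exists>k\<in>{1..<n}. \<exists>l\<in>{1..<n}. k \<noteq> l \<and> landmark_row m k = i \<and> landmark_row m l = i"
    if "i \<in> {1..m}" for i
    using that n by (intro bexI[of _ i] bexI[of _ "m + i"]) (auto simp: landmark_row_def)
  have dist: "graph_dist ?P (i, j) (landmark_row m k, k) =
      star_dist i (landmark_row m k) + star_dist j k"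
    if "i \<le> m" "j \<le> n" "k \<in> {1..<n}" for i j k
    using graph_dist_cartesian_product[OF pair_graph_star_graph strongly_connected_star_graph
        pair_graph_star_graph strongly_connected_star_graph, of i m j n "landmark_row m k" k]
      that row_le[OF that(3)]
    by (simp add: graph_dist_star_graph) (simp add: star_graph_def)
  have verts: "pverts ?P = {0..m} \<times> {0..n}"
    by (simp add: cartesian_product_def star_graph_def)
  have "x = y"
    if xy: "x \<in> pverts ?P" "y \<in> pverts ?P"
      and eq: "\<forall>w\<in>?W. graph_dist ?P x w = graph_dist ?P y w" for x y
  proof -
    obtain i j i' j' where ij: "x = (i, j)" "y = (i', j')" "i \<le> m" "j \<le> n" "i' \<le> m" "j' \<le> n"
      using xy unfolding verts by auto
    have "star_dist i (landmark_row m k) + star_dist j k =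
        star_dist i' (landmark_row m k) + star_dist j' k" if "k \<in> {1..<n}" for k
      using eq that dist ij by auto
    then have "i = i' \<and> j = j'"
      using star_dist_sum_separates[of m n "landmark_row m" i i' j j'] m n row_le twice ij
      by simp
    then show ?thesis
      using ij by simp
  qed
  moreover have "?W \<subseteq> pverts ?P"
    using row_le unfolding verts by fastforce
  ultimately show ?thesis
    unfolding resolving_set_iff by blast
qed

theorem theorem3:
  fixes m n :: nat
  assumes "2 \<le> m" and "real m < real n / 2"
  shows "metric_dim (star_graph m \<box> star_graph n) = n - 1"
  unfolding metric_dim_def
proof (rule Least_equality)
  have "2 * m < n"
    using assms(2) by linarith
  then have "resolving_set (star_graph m \<box> star_graph n)
      ((\<lambda>k. (landmark_row m k, k)) ` {1..<n})"
    using assms(1) by (rule resolving_set_star_product[rotated])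
  moreover have "card ((\<lambda>k. (landmark_row m k, k)) ` {1..<n}) = n - 1"
    by (subst card_image) (auto simp: inj_on_def)
  ultimately show "\<exists>W. resolving_set (star_graph m \<box> star_graph n) W \<and> card W = n - 1"
    by blast
next
  fix k
  assume "\<exists>W. resolving_set (star_graph m \<box> star_graph n) W \<and> card W = k"
  then show "n - 1 \<le> k"
    using card_resolving_set_product_star[OF pair_graph_star_graph strongly_connected_star_graph]
    by blast
qed

end
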